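(* Let $n\ge p\ge 1$ be integers, and let $H\in\mathbb{R}^{p\times p}$ and $Q\in\mathbb{R}^{n\times n}$ be real symmetric matrices. The following two statements are equivalent: (i) $\{X\in\mathbb{R}^{n\times p}:\ \mathrm{tr}(HX^TQX)<0,\ X^TX=I_p\}=\emptyset$. (ii) There exist a real symmetric matrix $M\in\mathbb{R}^{p\times p}$ and a real symmetric positive semidefinite matrix $W\in\mathbb{R}^{n\times n}$ such that $$\mathrm{tr}(HX^TQX)+\mathrm{tr}\big(M(X^TX-I_p)\big)+\mathrm{tr}\big(W(XX^T-I_n)\big)\ge 0\quad\text{for all }X\in\mathbb{R}^{n\times p}.$$
   Context: $I_k$ denotes the $k\times k$ identity matrix. *)

theory Defs
  imports "HOL-Analysis.Analysis"
begin

definition symmetric_matrix :: "real ^ 'n ^ 'n \<Rightarrow> bool" where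
  "symmetric_matrix A \<longleftrightarrow> transpose A = A"

definition psd_matrix :: "real ^ 'n ^ 'n \<Rightarrow> bool" where
  "psd_matrix A \<longleftrightarrow> symmetric_matrix A \<and> (\<forall>x. 0 \<le> x \<bullet> (A *v x))"

end

theory Submission
  imports Defs
begin

text \<open>
  Diagonalize \<open>H = P diag(h) P\<^sup>T\<close> and \<open>Q = R diag(q) R\<^sup>T\<close>. With \<open>M = P diag(m) P\<^sup>T\<close>,
  \<open>W = R diag(w) R\<^sup>T\<close> and \<open>Y = R\<^sup>T X P\<close>, the Lagrangian in (ii) becomes
  \<open>\<Sum>\<^sub>i\<^sub>j (h\<^sub>i q\<^sub>j + m\<^sub>i + w\<^sub>j) Y\<^sub>j\<^sub>i\<^sup>2 - \<Sum> m - \<Sum> w\<close>, so a certificate is a dual solution of the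
  assignment problem with costs \<open>h\<^sub>i q\<^sub>j\<close>. Evaluating (i) at \<open>X = R E P\<^sup>T\<close> for the 0/1 matrix \<open>E\<close> of an
  injection shows that every assignment has nonnegative cost. Product costs have explicit optimal
  potentials: pad \<open>h\<close> by zeros to length \<open>n\<close> and sort \<open>h\<close> increasingly and \<open>q\<close> decreasingly. The
  padded rows share one potential, and shifting it to 0 forces \<open>w \<ge> 0\<close>.

  Conversely, if \<open>X\<^sup>T X = I\<close> then \<open>K = I - X X\<^sup>T\<close> is an orthogonal projection, hence
  \<open>tr (W K) = tr (K\<^sup>T W K) \<ge> 0\<close>, and (ii) gives (i).
\<close>

section \<open>Spectral theorem for real symmetric matrices\<close>

lemma symmetric_matrix_dot:
  fixes A :: "real^'n^'n"
  assumes "symmetric_matrix A"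
  shows "x \<bullet> (A *v y) = (A *v x) \<bullet> y"
  using assms by (metis dot_lmul_matrix symmetric_matrix_def transpose_matrix_vector)

text \<open>The quadratic vanishes at \<open>t = 0\<close> and is never negative, so 0 is a minimum
  and the derivative \<open>2 * b\<close> there must be 0.\<close>

lemma linear_coeff_zero:
  fixes b c :: real
  assumes "\<And>t. 0 \<le> 2 * t * b + t\<^sup>2 * c"
  shows "b = 0"
proof (rule ccontr)
  assume b: "b \<noteq> 0"
  \<comment> \<open>Chosen so that \<open>d > 0\<close> and \<open>c < 2 * d\<close> whatever the
    sign of \<open>c\<close>; the quadratic is then negative at \<open>t = - b / d\<close>.\<close>
  define d where "d = \<bar>c\<bar> + 1"
  have d: "d > 0" "c < 2 * d" by (auto simp: d_def)
  have "2 * (- b / d) * b + (- b / d)\<^sup>2 * c = (b\<^sup>2 / d\<^sup>2) * (c - 2 * d)"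
    using d by (simp add: field_simps power2_eq_square)
  moreover have "(b\<^sup>2 / d\<^sup>2) * (c - 2 * d) < 0"
    using b d by (intro mult_pos_neg) auto
  ultimately show False using assms[of "- b / d"] by simp
qed

text \<open>The eigenvector maximizes the Rayleigh quotient on the orthogonal complement of \<open>S\<close>.\<close>

lemma eigenvector_orthogonal_to_eigenvectors:
  fixes A :: "real^'n^'n"
  assumes sym: "symmetric_matrix A"
    and eig: "\<And>s. s \<in> S \<Longrightarrow> \<exists>c. A *v s = c *\<^sub>R s"
    and S: "finite S" "card S < CARD('n)"
  obtains v c where "norm v = 1" "A *v v = c *\<^sub>R v" "\<And>s. s \<in> S \<Longrightarrow> s \<bullet> v = 0"
proof -
  define T where "T = {x. \<forall>s\<in>S. s \<bullet> x = 0}"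
  have Tsub: "subspace T"
    by (auto simp: T_def subspace_def inner_right_distrib)
  \<comment> \<open>Fewer vectors than the dimension leave a nonzero \<open>z\<close> orthogonal to
    all of \<open>S\<close>, so the unit sphere of \<open>T\<close> is nonempty.\<close>
  have "dim (span S) < DIM(real^'n)"
    using S dim_le_card[of S S] by (simp add: span_superset)
  then obtain z where z: "z \<noteq> 0" "\<And>y. y \<in> span (span S) \<Longrightarrow> orthogonal z y"
    using orthogonal_to_subspace_exists by blast
  have "z \<in> T"
    using z by (auto simp: T_def orthogonal_def inner_commute span_base)
  have "closed T"
  proof -
    have "T = (\<Inter>s\<in>S. {x. s \<bullet> x = 0})" by (auto simp: T_def)
    then show ?thesis by (auto intro!: closed_hyperplane)
  qed
  then have "compact (sphere 0 1 \<inter> T)" by (simp add: compact_Int_closed)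
  moreover have "z /\<^sub>R norm z \<in> sphere 0 1 \<inter> T"
    using z(1) \<open>z \<in> T\<close> Tsub by (auto simp: subspace_scale)
  then have "sphere 0 1 \<inter> T \<noteq> {}" by blast
  moreover have "continuous_on (sphere 0 1 \<inter> T) (\<lambda>x. x \<bullet> (A *v x))"
    by (intro continuous_on_inner continuous_on_id matrix_vector_mult_linear_continuous_on)
  ultimately obtain v where v: "v \<in> sphere 0 1 \<inter> T"
    and max: "\<And>x. x \<in> sphere 0 1 \<inter> T \<Longrightarrow> x \<bullet> (A *v x) \<le> v \<bullet> (A *v v)"
    using continuous_attains_sup[of "sphere 0 1 \<inter> T" "\<lambda>x. x \<bullet> (A *v x)"] by blast
  define c where "c = v \<bullet> (A *v v)"
  have vT: "v \<in> T" and nv: "norm v = 1" using v by auto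
  have nonneg: "0 \<le> c * (x \<bullet> x) - x \<bullet> (A *v x)" if "x \<in> T" for x
  proof (cases "x = 0")
    case False
    have "x /\<^sub>R norm x \<in> sphere 0 1 \<inter> T"
      using False that Tsub by (auto simp: subspace_scale)
    from max[OF this] have "(x \<bullet> (A *v x)) / (norm x)\<^sup>2 \<le> c"
      by (simp add: c_def matrix_vector_mult_scaleR power2_eq_square divide_inverse mult_ac)
    with False show ?thesis
      by (simp add: dot_square_norm pos_divide_le_eq)
  qed simp
  \<comment> \<open>The residual of the eigenvalue equation, used as the direction in which the
    maximizer \<open>v\<close> is perturbed.\<close>
  define w where "w = A *v v - c *\<^sub>R v"
  \<comment> \<open>\<open>T\<close> is invariant under \<open>A\<close>: symmetry moves
    \<open>A\<close> onto \<open>s\<close>, which it only rescales.\<close>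
  have wT: "w \<in> T"
  proof -
    have "s \<bullet> (A *v v) = 0" if "s \<in> S" for s
      using eig[OF that] vT that by (auto simp: symmetric_matrix_dot[OF sym] T_def)
    then show ?thesis
      using vT by (auto simp: w_def T_def inner_diff_right)
  qed
  \<comment> \<open>This is \<open>nonneg\<close> at \<open>v + t *\<^sub>R w\<close>. The constant
    terms cancel because \<open>v\<close> attains \<open>c\<close>, and the linear coefficient
    reduces to \<open>- (w \<bullet> w)\<close>, which must therefore be 0.\<close>
  have "0 \<le> 2 * t * (- (w \<bullet> w)) + t\<^sup>2 * (c * (w \<bullet> w) - w \<bullet> (A *v w))" for t
  proof -
    have Aw: "v \<bullet> (A *v w) = w \<bullet> (A *v v)"
      using symmetric_matrix_dot[OF sym, of v w] by (simp add: inner_commute)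
    have "w \<bullet> w = w \<bullet> (A *v v - c *\<^sub>R v)" by (simp add: w_def)
    then have ww: "w \<bullet> (A *v v) = w \<bullet> w + c * (w \<bullet> v)"
      by (simp add: inner_diff_right)
    have vv: "v \<bullet> v = 1" using nv by (simp add: dot_square_norm)
    let ?x = "v + t *\<^sub>R w"
    have norm_x: "?x \<bullet> ?x = 1 + 2 * t * (w \<bullet> v) + t\<^sup>2 * (w \<bullet> w)"
      by (simp add: inner_add_left inner_add_right vv inner_commute[of v w] power2_eq_square algebra_simps)
    have form_x: "?x \<bullet> (A *v ?x) = c + 2 * t * (w \<bullet> (A *v v)) + t\<^sup>2 * (w \<bullet> (A *v w))"
      by (simp add: inner_add_left inner_add_right matrix_vector_right_distrib
          matrix_vector_mult_scaleR Aw power2_eq_square distrib_left flip: c_def)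
    have "?x \<in> T"
      using vT wT Tsub by (simp add: subspace_add subspace_scale)
    from nonneg[OF this] show ?thesis
      unfolding norm_x form_x ww by (simp add: algebra_simps)
  qed
  then have "w \<bullet> w = 0" using linear_coeff_zero by fastforce
  then have "A *v v = c *\<^sub>R v" by (simp add: w_def)
  with nv vT show thesis by (intro that) (auto simp: T_def)
qed

lemma orthonormal_eigenvectors_exist:
  fixes A :: "real^'n^'n"
  assumes sym: "symmetric_matrix A" and "k \<le> CARD('n)"
  shows "\<exists>S. finite S \<and> card S = k \<and> pairwise orthogonal S \<and>
    (\<forall>s\<in>S. norm s = 1 \<and> (\<exists>c. A *v s = c *\<^sub>R s))"
  using assms(2)
proof (induction k)
  case 0
  show ?case by (intro exI[of _ "{}"]) simp
next
  case (Suc k)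
  then obtain S where S: "finite S" "card S = k" "pairwise orthogonal S"
    "\<And>s. s \<in> S \<Longrightarrow> norm s = 1 \<and> (\<exists>c. A *v s = c *\<^sub>R s)"
    by auto
  obtain v c where v: "norm v = 1" "A *v v = c *\<^sub>R v" "\<And>s. s \<in> S \<Longrightarrow> s \<bullet> v = 0"
    using eigenvector_orthogonal_to_eigenvectors[OF sym, of S] S Suc.prems
    by (metis Suc_le_lessD)
  have "v \<notin> S" using v(1,3) by fastforce
  with S v show ?case
    by (intro exI[of _ "insert v S"])
      (auto simp: pairwise_insert orthogonal_def[abs_def] inner_commute)
qed

definition diag_matrix :: "('n \<Rightarrow> real) \<Rightarrow> real^'n^'n" where
  "diag_matrix d = (\<chi> i j. if i = j then d i else 0)"

text \<open>Orthonormal eigenvectors, indexed through a bijection with the index type, become the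
  columns of \<open>P\<close>; then \<open>A ** P = P ** diag_matrix d\<close>, and
  \<open>transpose P\<close> is cancelled on the right.\<close>

lemma symmetric_matrix_diagonalization:
  fixes A :: "real^'n^'n"
  assumes sym: "symmetric_matrix A"
  obtains P d where "orthogonal_matrix P" "A = P ** diag_matrix d ** transpose P"
proof -
  obtain S where S: "finite S" "card S = CARD('n)" "pairwise orthogonal S"
    "\<And>s. s \<in> S \<Longrightarrow> norm s = 1 \<and> (\<exists>c. A *v s = c *\<^sub>R s)"
    using orthonormal_eigenvectors_exist[OF sym order_refl] by blast
  then obtain e :: "'n \<Rightarrow> real^'n" where e: "bij_betw e UNIV S"
    using finite_same_card_bij[of "UNIV :: 'n set" S] by auto
  have "\<forall>i. \<exists>c. A *v e i = c *\<^sub>R e i"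
    using S(4) e bij_betwE by blast
  then obtain d where d: "\<And>i. A *v e i = d i *\<^sub>R e i" by metis
  define P :: "real^'n^'n" where "P = (\<chi> i j. e j $ i)"
  have col: "column j P = e j" for j by (simp add: P_def column_def)
  have orth: "orthogonal_matrix P"
    unfolding orthogonal_matrix_orthonormal_columns col
  proof safe
    show "norm (e i) = 1" for i using S(4) e bij_betwE by blast
    show "orthogonal (e i) (e j)" if "i \<noteq> j" for i j
      using S(3) e that unfolding pairwise_def bij_betw_def inj_on_def by blast
  qed
  have "A ** P = P ** diag_matrix d"
  proof -
    have "(A ** P) $ i $ j = (A *v e j) $ i" for i j
      by (simp add: matrix_matrix_mult_def matrix_vector_mult_def P_def)
    moreover have "(P ** diag_matrix d) $ i $ j = (d j *\<^sub>R e j) $ i" for i j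
      by (simp add: matrix_matrix_mult_def diag_matrix_def P_def if_distrib cong: if_cong)
    ultimately show ?thesis by (simp add: vec_eq_iff d)
  qed
  then have "A ** (P ** transpose P) = P ** diag_matrix d ** transpose P"
    by (simp add: matrix_mul_assoc)
  then show thesis using orth by (intro that[of P d]) (auto simp: orthogonal_matrix_def)
qed

section \<open>Assignment duality for product costs\<close>

text \<open>The index types carry no order, so sorting means passing to positions
  \<open>0, ..., CARD('a) - 1\<close>, along which increments can be summed.\<close>

lemma sorted_enumeration:
  fixes f :: "'a::finite \<Rightarrow> 'b::linorder"
  obtains \<alpha> where "bij_betw \<alpha> {..<CARD('a)} UNIV" "mono_on {..<CARD('a)} (f \<circ> \<alpha>)"
proof -
  obtain xs :: "'a list" where xs: "set xs = UNIV" "distinct xs"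
    using finite_distinct_list[OF finite_class.finite_UNIV] by auto
  define ys where "ys = sort_key f xs"
  have ys: "set ys = UNIV" "distinct ys" "sorted (map f ys)"
    using xs by (auto simp: ys_def)
  then have len: "length ys = CARD('a)" using distinct_card by metis
  show thesis
  proof
    show "bij_betw ((!) ys) {..<CARD('a)} UNIV"
      using bij_betw_nth[OF ys(2), of "{..<CARD('a)}" UNIV] ys(1) len by simp
    show "mono_on {..<CARD('a)} (f \<circ> (!) ys)"
      using ys(3) len by (auto intro!: mono_onI simp: sorted_iff_nth_mono)
  qed
qed

text \<open>
  \<open>\<mu>\<close> is a discrete \<open>-\<integral> b da\<close>: the potential that makes the diagonal assignment tight for the costs
  \<open>a i * b j\<close>.
\<close>

lemma oppositely_sorted_potential_bounds:
  fixes a b :: "nat \<Rightarrow> real"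
  assumes a: "mono_on {..<N} a" and b: "antimono_on {..<N} b"
    and "j \<le> i" "i < N"
  defines "\<mu> \<equiv> \<lambda>k. - (\<Sum>l<k. (a (Suc l) - a l) * b l)"
  shows "- (a i - a j) * b j \<le> \<mu> i - \<mu> j" "\<mu> i - \<mu> j \<le> - (a i - a j) * b i"
proof -
  have "- (a i - a j) * b j \<le> \<mu> i - \<mu> j \<and> \<mu> i - \<mu> j \<le> - (a i - a j) * b i"
    using \<open>j \<le> i\<close> \<open>i < N\<close>
  proof (induction i rule: dec_induct)
    case (step k)
    have inc: "a j \<le> a k" "a k \<le> a (Suc k)" and dec: "b k \<le> b j" "b (Suc k) \<le> b k"
      using step by (auto intro!: monotone_onD[OF a] monotone_onD[OF b])
    \<comment> \<open>The first inequality extends the lower bound by one increment; the second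
      replaces \<open>b k\<close> by \<open>b (Suc k)\<close> in the extended upper bound.\<close>
    have "(a (Suc k) - a k) * b k \<le> (a (Suc k) - a k) * b j"
      "(a (Suc k) - a j) * b (Suc k) \<le> (a (Suc k) - a j) * b k"
      using inc dec by (auto intro!: mult_left_mono)
    with step show ?case by (auto simp: \<mu>_def algebra_simps)
  qed simp
  then show "- (a i - a j) * b j \<le> \<mu> i - \<mu> j" "\<mu> i - \<mu> j \<le> - (a i - a j) * b i"
    by auto
qed

text \<open>By rearrangement the cheapest assignment pairs the k-th smallest \<open>f\<close> with
  the k-th largest \<open>g\<close>. The potential \<open>\<mu>\<close> serves the rows, and
  \<open>w\<close> is whatever makes these pairs tight. Equal potentials for equal values of
  \<open>f\<close> are what the zero-padded rows rely on later.\<close>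

lemma product_cost_potentials:
  fixes f g :: "'a::finite \<Rightarrow> real"
  shows "\<exists>\<pi> m w. bij \<pi> \<and> (\<forall>i j. 0 \<le> f i * g j + m i + w j) \<and>
    (\<forall>i. m i + w (\<pi> i) = - (f i * g (\<pi> i))) \<and> (\<forall>i j. f i = f j \<longrightarrow> m i = m j)"
proof -
  let ?N = "CARD('a)"
  obtain \<alpha> where \<alpha>: "bij_betw \<alpha> {..<?N} UNIV" "mono_on {..<?N} (f \<circ> \<alpha>)"
    using sorted_enumeration by metis
  obtain \<beta> where \<beta>: "bij_betw \<beta> {..<?N} UNIV" "mono_on {..<?N} ((\<lambda>x. - g x) \<circ> \<beta>)"
    using sorted_enumeration by metis
  define a where "a = f \<circ> \<alpha>"
  define b where "b = g \<circ> \<beta>"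
  have mono: "mono_on {..<?N} a" "antimono_on {..<?N} b"
    using \<alpha>(2) \<beta>(2) by (auto simp: a_def b_def monotone_on_def)
  define \<mu> where "\<mu> k = - (\<Sum>l<k. (a (Suc l) - a l) * b l)" for k
  note pot = oppositely_sorted_potential_bounds[OF mono, folded \<mu>_def]
  define \<alpha>' where "\<alpha>' = inv_into {..<?N} \<alpha>"
  define \<beta>' where "\<beta>' = inv_into {..<?N} \<beta>"
  have bij': "bij_betw \<alpha>' UNIV {..<?N}" "bij_betw \<beta>' UNIV {..<?N}"
    using \<alpha>(1) \<beta>(1) by (simp_all add: \<alpha>'_def \<beta>'_def bij_betw_inv_into)
  have lt: "\<alpha>' x < ?N" "\<beta>' x < ?N" for x
    using bij' bij_betwE by blast+
  have inv: "a (\<alpha>' x) = f x" "b (\<beta>' x) = g x" for x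
    using \<alpha>(1) \<beta>(1) by (simp_all add: \<alpha>'_def \<beta>'_def a_def b_def bij_betw_inv_into_right)
  show ?thesis
  proof (intro exI conjI allI impI)
    show "bij (\<beta> \<circ> \<alpha>')"
      using bij_betw_trans[OF bij'(1) \<beta>(1)] .
    \<comment> \<open>With \<open>i\<close>, \<open>j\<close> the positions of \<open>x\<close>,
      \<open>y\<close>, the claim is \<open>- (a i - a j) * b j \<le> \<mu> i - \<mu> j\<close>: the
      lower bound if \<open>j \<le> i\<close>, otherwise the upper bound with \<open>i\<close> and
      \<open>j\<close> exchanged.\<close>
    show "0 \<le> f x * g y + \<mu> (\<alpha>' x) + (- a (\<beta>' y) * b (\<beta>' y) - \<mu> (\<beta>' y))" for x y
      using pot[of "\<alpha>' x" "\<beta>' y"] pot[of "\<beta>' y" "\<alpha>' x"] lt[of x] lt[of y]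
      by (cases "\<beta>' y \<le> \<alpha>' x") (auto simp: inv algebra_simps)
    show "\<mu> (\<alpha>' x) + (- a (\<beta>' ((\<beta> \<circ> \<alpha>') x)) * b (\<beta>' ((\<beta> \<circ> \<alpha>') x)) - \<mu> (\<beta>' ((\<beta> \<circ> \<alpha>') x)))
        = - (f x * g ((\<beta> \<circ> \<alpha>') x))" for x
    proof -
      have "\<beta>' (\<beta> (\<alpha>' x)) = \<alpha>' x"
        using \<beta>(1) lt by (simp add: \<beta>'_def bij_betw_inv_into_left)
      then show ?thesis using inv(1)[of x] by (simp add: b_def)
    qed
    \<comment> \<open>Both bounds on the difference of potentials are 0 when the values of
      \<open>f\<close> agree.\<close>
    show "\<mu> (\<alpha>' x) = \<mu> (\<alpha>' y)" if "f x = f y" for x y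
      using pot[of "\<alpha>' x" "\<alpha>' y"] pot[of "\<alpha>' y" "\<alpha>' x"] lt[of x] lt[of y] that
      by (cases "\<alpha>' y \<le> \<alpha>' x") (auto simp: inv)
  qed
qed

lemma product_cost_assignment_duality:
  fixes h :: "'p::finite \<Rightarrow> real" and q :: "'n::finite \<Rightarrow> real"
  assumes "CARD('p) \<le> CARD('n)"
    and pos: "\<And>\<sigma> :: 'p \<Rightarrow> 'n. inj \<sigma> \<Longrightarrow> 0 \<le> (\<Sum>i\<in>UNIV. h i * q (\<sigma> i))"
  obtains m w where "\<And>i j. 0 \<le> h i * q j + m i + w j" "\<And>j. 0 \<le> w j"
    "sum m UNIV + sum w UNIV \<le> 0"
proof -
  obtain e :: "'p \<Rightarrow> 'n" where e: "inj e"
    using card_le_inj[of "UNIV :: 'p set" "UNIV :: 'n set"] assms(1) by auto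
  define h' where "h' x = (if x \<in> range e then h (inv e x) else 0)" for x
  have h'e: "h' (e i) = h i" for i using e by (simp add: h'_def)
  obtain \<pi> m w where pot: "bij \<pi> \<and> (\<forall>x y. 0 \<le> h' x * q y + m x + w y) \<and>
    (\<forall>x. m x + w (\<pi> x) = - (h' x * q (\<pi> x))) \<and> (\<forall>x y. h' x = h' y \<longrightarrow> m x = m y)"
    using product_cost_potentials[of h' q] by (elim exE)
  from pot have \<pi>: "bij \<pi>" by (rule conjunct1)
  from pot have le: "0 \<le> h' x * q y + m x + w y" for x y by fast
  from pot have eq: "m x + w (\<pi> x) = - (h' x * q (\<pi> x))" for x by fast
  from pot have meq: "h' x = h' y \<Longrightarrow> m x = m y" for x y by fast
  \<comment> \<open>Subtracting \<open>c\<close> from all \<open>m\<close> and adding it to all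
    \<open>w\<close> preserves every sum \<open>m x + w y\<close>. A padded row has cost 0, so
    taking its potential as \<open>c\<close> gives \<open>w y + c \<ge> 0\<close>; without padding,
    \<open>c\<close> is minus the minimum of \<open>w\<close>.\<close>
  obtain c where c: "\<And>y. 0 \<le> w y + c" "\<And>x. x \<notin> range e \<Longrightarrow> m x = c"
  proof (cases "range e = UNIV")
    case True
    define l where "l = Min (range w)"
    have "l \<le> w y" for y unfolding l_def by (rule Min_le) auto
    with True show thesis by (intro that[of "- l"]) auto
  next
    case False
    then obtain x where x: "x \<notin> range e" by blast
    show thesis
    proof
      show "0 \<le> w y + m x" for y using le[of x y] x by (simp add: h'_def add.commute)
      show "m z = m x" if "z \<notin> range e" for z using x that by (intro meq) (simp add: h'_def)
    qed
  qed
  have "(\<Sum>i\<in>UNIV. m (e i) - c) = (\<Sum>x\<in>range e. m x - c)"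
    by (simp add: sum.reindex[OF e])
  also have "\<dots> = (\<Sum>x\<in>UNIV. m x - c)"
    using c(2) by (intro sum.mono_neutral_left) auto
  finally have m: "(\<Sum>i\<in>UNIV. m (e i) - c) = (\<Sum>x\<in>UNIV. m x - c)" .
  have w: "(\<Sum>y\<in>UNIV. w y + c) = (\<Sum>x\<in>UNIV. w (\<pi> x) + c)"
    using sum.reindex_bij_betw[OF \<pi>, of "\<lambda>y. w y + c"] by simp
  have "(\<Sum>x\<in>UNIV. h' x * q (\<pi> x)) = (\<Sum>x\<in>range e. h' x * q (\<pi> x))"
    by (intro sum.mono_neutral_right) (auto simp: h'_def)
  also have "\<dots> = (\<Sum>i\<in>UNIV. h i * q ((\<pi> \<circ> e) i))"
    by (simp add: sum.reindex[OF e] h'e)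
  finally have h: "(\<Sum>x\<in>UNIV. h' x * q (\<pi> x)) = (\<Sum>i\<in>UNIV. h i * q ((\<pi> \<circ> e) i))" .
  show thesis
  proof
    show "0 \<le> h i * q j + (m (e i) - c) + (w j + c)" for i j
      using le[of "e i" j] by (simp add: h'e)
    show "0 \<le> w j + c" for j by (rule c(1))
    \<comment> \<open>Summing along \<open>\<pi>\<close> cancels \<open>c\<close>. Tightness turns
      the dual value into minus the cost of the injection \<open>\<pi> \<circ> e\<close>, which
      \<open>pos\<close> controls.\<close>
    have "(\<Sum>i\<in>UNIV. m (e i) - c) + (\<Sum>y\<in>UNIV. w y + c)
        = (\<Sum>x\<in>UNIV. m x + w (\<pi> x))"
      unfolding m w by (simp flip: sum.distrib)
    also have "\<dots> = - (\<Sum>i\<in>UNIV. h i * q ((\<pi> \<circ> e) i))"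
      unfolding h[symmetric] by (simp only: eq sum_negf)
    also have "\<dots> \<le> 0"
      using pos[of "\<pi> \<circ> e"] \<pi> e by (simp add: inj_compose bij_is_inj)
    finally show "(\<Sum>i\<in>UNIV. m (e i) - c) + (\<Sum>y\<in>UNIV. w y + c) \<le> 0" .
  qed
qed

section \<open>Trace forms in spectral coordinates\<close>

lemma trace_diag_matrix_quadratic:
  fixes Y :: "real^'p^'n"
  shows "trace (diag_matrix h ** transpose Y ** diag_matrix q ** Y)
    = (\<Sum>i\<in>UNIV. \<Sum>j\<in>UNIV. h i * q j * (Y $ j $ i)\<^sup>2)"
proof -
  have "(diag_matrix h ** transpose Y) $ i $ j = h i * Y $ j $ i" for i j
    by (simp add: matrix_matrix_mult_def diag_matrix_def transpose_def if_distrib if_distribR cong: if_cong)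
  moreover have "(diag_matrix h ** transpose Y ** diag_matrix q) $ i $ j
      = (diag_matrix h ** transpose Y) $ i $ j * q j" for i j
    unfolding matrix_matrix_mult_def[of _ "diag_matrix q"]
    by (simp add: diag_matrix_def[of q] if_distrib cong: if_cong)
  ultimately show ?thesis
    by (simp add: trace_def matrix_matrix_mult_def[of _ Y] power2_eq_square mult_ac)
qed

lemma trace_conjugate_diag_matrix:
  assumes "orthogonal_matrix P"
  shows "trace (P ** diag_matrix d ** transpose P) = sum d UNIV"
proof -
  have "trace (P ** diag_matrix d ** transpose P) = trace (transpose P ** P ** diag_matrix d)"
    using trace_mul_sym by (metis matrix_mul_assoc)
  then show ?thesis
    using assms by (simp add: orthogonal_matrix trace_def diag_matrix_def)
qed

text \<open>Cyclicity of the trace carries the leading \<open>P\<close> to the end, completing the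
  factor \<open>transpose R ** X ** P\<close>. All three quadratic terms of the Lagrangian are
  instances, with \<open>h\<close> or \<open>q\<close> constantly 1 in two of them.\<close>

lemma trace_conjugate_diag_matrix_quadratic:
  fixes X :: "real^'p^'n"
  shows "trace ((P ** diag_matrix h ** transpose P) ** transpose X
      ** (R ** diag_matrix q ** transpose R) ** X)
    = (\<Sum>i\<in>UNIV. \<Sum>j\<in>UNIV. h i * q j * ((transpose R ** X ** P) $ j $ i)\<^sup>2)"
proof -
  have "trace ((P ** diag_matrix h ** transpose P) ** transpose X
      ** (R ** diag_matrix q ** transpose R) ** X)
    = trace (P ** (diag_matrix h ** transpose (transpose R ** X ** P) ** diag_matrix q
        ** (transpose R ** X)))"
    by (simp add: matrix_transpose_mul matrix_mul_assoc)
  also have "\<dots> = trace (diag_matrix h ** transpose (transpose R ** X ** P) ** diag_matrix q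
        ** (transpose R ** X ** P))"
    by (subst trace_mul_sym) (simp add: matrix_mul_assoc)
  finally show ?thesis by (simp only: trace_diag_matrix_quadratic)
qed

lemma symmetric_conjugate_diag_matrix:
  "symmetric_matrix (P ** diag_matrix d ** transpose P)"
proof -
  have "transpose (diag_matrix d) = diag_matrix d"
    by (auto simp: transpose_def diag_matrix_def vec_eq_iff)
  then show ?thesis
    by (simp add: symmetric_matrix_def matrix_transpose_mul matrix_mul_assoc)
qed

lemma psd_conjugate_diag_matrix:
  assumes "\<And>i. 0 \<le> d i"
  shows "psd_matrix (P ** diag_matrix d ** transpose P)"
  unfolding psd_matrix_def
proof (intro conjI allI symmetric_conjugate_diag_matrix)
  fix x
  define y where "y = transpose P *v x"
  have "x \<bullet> ((P ** diag_matrix d ** transpose P) *v x) = y \<bullet> (diag_matrix d *v y)"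
    by (metis dot_lmul_matrix matrix_vector_mul_assoc transpose_matrix_vector y_def)
  also have "\<dots> = (\<Sum>i\<in>UNIV. d i * (y $ i)\<^sup>2)"
    by (simp add: inner_vec_def matrix_vector_mult_def diag_matrix_def if_distrib if_distribR
        power2_eq_square mult_ac cong: if_cong)
  also have "\<dots> \<ge> 0" using assms by (simp add: sum_nonneg)
  finally show "0 \<le> x \<bullet> ((P ** diag_matrix d ** transpose P) *v x)" .
qed

lemma conjugate_diag_matrix_one:
  assumes "orthogonal_matrix P"
  shows "P ** diag_matrix (\<lambda>_. 1) ** transpose P = mat 1"
proof -
  have "diag_matrix (\<lambda>_. 1) = mat 1" by (simp add: diag_matrix_def mat_def)
  with assms show ?thesis by (metis matrix_mul_rid orthogonal_matrix_def)
qed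

lemma matrix_diff_ldistrib: "A ** (B - C) = A ** B - A ** (C :: 'a::ring_1^'p^'n)"
  by (simp add: matrix_matrix_mult_def vec_eq_iff right_diff_distrib sum_subtractf)

lemma matrix_diff_rdistrib: "(A - B) ** C = A ** C - B ** (C :: 'a::ring_1^'p^'n)"
  by (simp add: matrix_matrix_mult_def vec_eq_iff left_diff_distrib sum_subtractf)

text \<open>Since \<open>K\<close> is an orthogonal projection, the trace equals that of
  \<open>transpose K ** W ** K\<close>, a sum of values of the quadratic form of \<open>W\<close> at
  the columns of \<open>K\<close>.\<close>

lemma trace_psd_mult_idempotent:
  fixes W K :: "real^'n^'n"
  assumes W: "psd_matrix W" and K: "transpose K = K" "K ** K = K"
  shows "0 \<le> trace (W ** K)"
proof -
  have "trace (W ** K) = trace (W ** K ** K)"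
    by (simp add: K(2) flip: matrix_mul_assoc)
  also have "\<dots> = trace (transpose K ** (W ** K))"
    by (simp add: trace_mul_sym[of "W ** K"] K(1))
  also have "\<dots> = (\<Sum>i\<in>UNIV. column i K \<bullet> (W *v column i K))"
    by (simp add: trace_def inner_vec_def matrix_matrix_mult_def matrix_vector_mult_def
        transpose_def column_def)
  also have "\<dots> \<ge> 0" using W by (simp add: psd_matrix_def sum_nonneg)
  finally show ?thesis .
qed

section \<open>Weak and strong Lagrangian duality over matrices with orthonormal columns\<close>

theorem theorem1:
  fixes H :: "real ^ 'p ^ 'p" and Q :: "real ^ 'n ^ 'n"
  assumes "CARD('p) \<le> CARD('n)"
    and "symmetric_matrix H" and "symmetric_matrix Q"
  shows "{X :: real ^ 'p ^ 'n.
            trace (H ** transpose X ** Q ** X) < 0 \<and> transpose X ** X = mat 1} = {}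
    \<longleftrightarrow>
    (\<exists>(M :: real ^ 'p ^ 'p) (W :: real ^ 'n ^ 'n).
        symmetric_matrix M \<and> psd_matrix W \<and>
        (\<forall>X :: real ^ 'p ^ 'n.
            0 \<le> trace (H ** transpose X ** Q ** X)
              + trace (M ** (transpose X ** X - mat 1))
              + trace (W ** (X ** transpose X - mat 1))))"
proof
  assume "\<exists>(M :: real ^ 'p ^ 'p) (W :: real ^ 'n ^ 'n).
        symmetric_matrix M \<and> psd_matrix W \<and>
        (\<forall>X :: real ^ 'p ^ 'n.
            0 \<le> trace (H ** transpose X ** Q ** X)
              + trace (M ** (transpose X ** X - mat 1))
              + trace (W ** (X ** transpose X - mat 1)))"
  then obtain M :: "real ^ 'p ^ 'p" and W :: "real ^ 'n ^ 'n" where W: "psd_matrix W"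
    and ge: "\<And>X :: real ^ 'p ^ 'n. 0 \<le> trace (H ** transpose X ** Q ** X)
              + trace (M ** (transpose X ** X - mat 1)) + trace (W ** (X ** transpose X - mat 1))"
    by blast
  have "0 \<le> trace (H ** transpose X ** Q ** X)" if X: "transpose X ** X = mat 1"
    for X :: "real ^ 'p ^ 'n"
  proof -
    \<comment> \<open>The projection onto the orthogonal complement of the column space of
      \<open>X\<close>. At a feasible \<open>X\<close> the \<open>M\<close> term vanishes and the
      \<open>W\<close> term is \<open>- trace (W ** K)\<close>.\<close>
    define K where "K = mat 1 - X ** transpose X"
    have "X ** transpose X ** (X ** transpose X) = X ** (transpose X ** X) ** transpose X"
      by (simp only: matrix_mul_assoc)
    then have "K ** K = K"
      by (simp add: K_def X matrix_diff_ldistrib matrix_diff_rdistrib)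
    moreover have "transpose K = K"
      by (simp add: K_def transpose_def vec_eq_iff matrix_matrix_mult_def mat_def mult.commute)
    ultimately have "0 \<le> trace (W ** K)" by (intro trace_psd_mult_idempotent W)
    moreover have "trace (W ** (X ** transpose X - mat 1)) = - trace (W ** K)"
      by (simp add: K_def matrix_diff_ldistrib trace_sub)
    ultimately show ?thesis using ge[of X] by (simp add: X trace_def)
  qed
  then show "{X :: real ^ 'p ^ 'n.
      trace (H ** transpose X ** Q ** X) < 0 \<and> transpose X ** X = mat 1} = {}"
    by (auto simp: not_less)
next
  assume "{X :: real ^ 'p ^ 'n.
      trace (H ** transpose X ** Q ** X) < 0 \<and> transpose X ** X = mat 1} = {}"
  then have pos: "0 \<le> trace (H ** transpose X ** Q ** X)" if "transpose X ** X = mat 1"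
    for X :: "real ^ 'p ^ 'n"
    using that not_less by blast
  obtain P h where P: "orthogonal_matrix P" and H: "H = P ** diag_matrix h ** transpose P"
    using symmetric_matrix_diagonalization[OF assms(2)] .
  obtain R q where R: "orthogonal_matrix R" and Q: "Q = R ** diag_matrix q ** transpose R"
    using symmetric_matrix_diagonalization[OF assms(3)] .
  have PR: "transpose P ** P = mat 1" "P ** transpose P = mat 1" "transpose R ** R = mat 1"
    using P R by (auto simp: orthogonal_matrix_def)
  have "0 \<le> (\<Sum>i\<in>UNIV. h i * q (\<sigma> i))" if \<sigma>: "inj \<sigma>" for \<sigma> :: "'p \<Rightarrow> 'n"
  proof -
    \<comment> \<open>The columns of \<open>E\<close> are distinct unit vectors by injectivity of
      \<open>\<sigma>\<close>, so \<open>X\<close> is feasible; in spectral coordinates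
      \<open>X\<close> is \<open>E\<close> again, and its objective is the assignment cost.\<close>
    define E :: "real ^ 'p ^ 'n" where "E = (\<chi> j i. if j = \<sigma> i then 1 else 0)"
    define X where "X = R ** E ** transpose P"
    have "E $ j $ i * E $ j $ k = (if j = \<sigma> i then of_bool (i = k) else 0)" for i j k
      using \<sigma> by (simp add: E_def inj_eq)
    then have "transpose E ** E = mat 1"
      by (simp add: matrix_matrix_mult_def transpose_def mat_def vec_eq_iff of_bool_def)
    moreover have "transpose X ** X = P ** (transpose E ** (transpose R ** R) ** E) ** transpose P"
      by (simp add: X_def matrix_transpose_mul matrix_mul_assoc)
    ultimately have "transpose X ** X = mat 1" by (simp add: PR)
    moreover have "transpose R ** X ** P = E"
    proof -
      have "transpose R ** X ** P = (transpose R ** R) ** E ** (transpose P ** P)"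
        by (simp only: X_def matrix_mul_assoc)
      then show ?thesis by (simp add: PR)
    qed
    moreover have "h i * q j * (E $ j $ i)\<^sup>2 = (if j = \<sigma> i then h i * q (\<sigma> i) else 0)" for i j
      by (simp add: E_def)
    ultimately show ?thesis
      using pos[of X] unfolding H Q trace_conjugate_diag_matrix_quadratic by simp
  qed
  then obtain m w where mw: "\<And>i j. 0 \<le> h i * q j + m i + w j" "\<And>j. 0 \<le> w j"
    "sum m UNIV + sum w UNIV \<le> 0"
    using product_cost_assignment_duality[OF assms(1)] by blast
  define M where "M = P ** diag_matrix m ** transpose P"
  define W where "W = R ** diag_matrix w ** transpose R"
  have "0 \<le> trace (H ** transpose X ** Q ** X) + trace (M ** (transpose X ** X - mat 1))
      + trace (W ** (X ** transpose X - mat 1))" for X :: "real ^ 'p ^ 'n"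
  proof -
    let ?Y = "transpose R ** X ** P"
    \<comment> \<open>Writing the identity as
      \<open>R ** diag_matrix (\<lambda>_. 1) ** transpose R\<close> brings the \<open>M\<close>
      term into the common quadratic form; the \<open>W\<close> term is treated likewise with
      \<open>P\<close>, after a cyclic shift.\<close>
    have "trace (M ** (transpose X ** X))
        = trace (M ** transpose X ** (R ** diag_matrix (\<lambda>_. 1) ** transpose R) ** X)"
      by (simp add: conjugate_diag_matrix_one R matrix_mul_assoc)
    then have M: "trace (M ** (transpose X ** X))
        = (\<Sum>i\<in>UNIV. \<Sum>j\<in>UNIV. m i * (?Y $ j $ i)\<^sup>2)"
      unfolding M_def trace_conjugate_diag_matrix_quadratic by simp
    have "trace (W ** (X ** transpose X))
        = trace ((P ** diag_matrix (\<lambda>_. 1) ** transpose P) ** transpose X ** W ** X)"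
      using trace_mul_sym[of "W ** X" "transpose X"]
      by (simp add: conjugate_diag_matrix_one P matrix_mul_assoc)
    then have W: "trace (W ** (X ** transpose X))
        = (\<Sum>i\<in>UNIV. \<Sum>j\<in>UNIV. w j * (?Y $ j $ i)\<^sup>2)"
      unfolding W_def trace_conjugate_diag_matrix_quadratic by simp
    have "trace M = sum m UNIV" "trace W = sum w UNIV"
      unfolding M_def W_def using P R by (simp_all add: trace_conjugate_diag_matrix)
    moreover have "trace (H ** transpose X ** Q ** X)
        = (\<Sum>i\<in>UNIV. \<Sum>j\<in>UNIV. h i * q j * (?Y $ j $ i)\<^sup>2)"
      unfolding H Q trace_conjugate_diag_matrix_quadratic ..
    ultimately have "trace (H ** transpose X ** Q ** X) + trace (M ** (transpose X ** X - mat 1))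
        + trace (W ** (X ** transpose X - mat 1))
      = (\<Sum>i\<in>UNIV. \<Sum>j\<in>UNIV. (h i * q j + m i + w j) * (?Y $ j $ i)\<^sup>2)
        - (sum m UNIV + sum w UNIV)"
      by (simp add: matrix_diff_ldistrib trace_sub M W sum.distrib ring_distribs)
    also have "\<dots> \<ge> 0"
      \<comment> \<open>The squares have nonnegative coefficients, and the constant left by the two
        identity matrices is minus the dual value.\<close>
      using mw(3) by (simp add: order_trans[OF mw(3)] sum_nonneg mw(1))
    finally show ?thesis .
  qed
  moreover have "symmetric_matrix M"
    unfolding M_def by (rule symmetric_conjugate_diag_matrix)
  moreover have "psd_matrix W"
    unfolding W_def using mw(2) by (rule psd_conjugate_diag_matrix)
  ultimately show "\<exists>(M :: real ^ 'p ^ 'p) (W :: real ^ 'n ^ 'n).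
        symmetric_matrix M \<and> psd_matrix W \<and>
        (\<forall>X :: real ^ 'p ^ 'n.
            0 \<le> trace (H ** transpose X ** Q ** X)
              + trace (M ** (transpose X ** X - mat 1))
              + trace (W ** (X ** transpose X - mat 1)))"
    by blast
qed

end
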